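(* Let $\{\alpha_i\}_{i\in\mathbb{N}}\subset\mathbb{T}$ be rationally independent numbers, and let $(m_n)_{n\geq 1}$ be an increasing sequence of natural numbers such that: (a) for every irrational $\theta\in\mathbb{R}\setminus\mathbb{Q}$ the sequence $(m_n\theta[1])_{n\geq 1}$ is dense in $\mathbb{T}$; (b) for every $\epsilon>0$ and every $k\in\mathbb{N}$ there exists $N_0\in\mathbb{N}$ such that for every $n\geq N_0$ the inequality $\|m_n\alpha_i\|<\epsilon$ holds for at least $k-1$ of the indices $i\in\{1,\dots,k\}$; (c) for every integer $k\geq 2$ the set $\{n\in\mathbb{N}: k\nmid m_n\}$ is infinite. Then there exists a continuous Borel probability measure $\mu$ on $\mathbb{T}$ such that $$\lim_{n\to+\infty}\int_{\mathbb{T}}\|m_n\theta\|\,d\mu(\theta)=0.$$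
   Context: $\mathbb{T}=\mathbb{R}/\mathbb{Z}$ is the circle group with addition mod $1$, and $\mathbb{N}=\{1,2,3,\dots\}$. For $\eta\in\mathbb{R}$, $\eta[1]$ denotes the fractional part of $\eta$ (viewed as a point of $\mathbb{T}$) and $\|\eta\|$ the distance from $\eta$ to the nearest integer; $\|\cdot\|$ is well defined on $\mathbb{T}$. The family $\{\alpha_i\}_{i\in\mathbb{N}}\subset\mathbb{T}$ is rationally independent if every finite subcollection is: for every $n$ and integers $k_1,\dots,k_n$, if $\sum_{i=1}^n k_i\alpha_i=0$ in $\mathbb{T}$ then $k_1=\dots=k_n=0$ (equivalently, for real representatives, $1,\alpha_1,\dots,\alpha_n$ are linearly independent over $\mathbb{Q}$ for every $n$). A measure on $\mathbb{T}$ is continuous if it has no atoms, i.e. $\mu(\{x\})=0$ for every $x\in\mathbb{T}$. *)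

theory Defs
  imports "HOL-Probability.Probability"
begin

definition int_cong :: "real \<Rightarrow> real \<Rightarrow> bool" where
  "int_cong x y \<longleftrightarrow> x - y \<in> \<int>"

lemma equivp_int_cong: "equivp int_cong"
proof (rule equivpI)
  show "reflp int_cong"
    by (simp add: reflp_def int_cong_def)
  show "symp int_cong"
  proof (rule sympI)
    fix x y assume "int_cong x y"
    then have "- (x - y) \<in> \<int>"
      unfolding int_cong_def by (rule Ints_minus)
    then show "int_cong y x"
      by (simp add: int_cong_def)
  qed
  show "transp int_cong"
  proof (rule transpI)
    fix x y z assume "int_cong x y" "int_cong y z"
    then have "(x - y) + (y - z) \<in> \<int>"
      unfolding int_cong_def by (rule Ints_add)
    then show "int_cong x z"
      by (simp add: int_cong_def)
  qed
qed

quotient_type circle = real / int_cong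
  by (rule equivp_int_cong)

lift_definition to_circle :: "real \<Rightarrow> circle" is "\<lambda>x. x" .

lemma to_circle_eq_iff: "to_circle x = to_circle y \<longleftrightarrow> x - y \<in> \<int>"
  by transfer (simp add: int_cong_def)

lemma circle_cases [case_names to_circle, cases type: circle]:
  obtains x where "t = to_circle x"
  by transfer (auto simp: int_cong_def)

instantiation circle :: ab_group_add
begin

lift_definition zero_circle :: circle is "0" .

lift_definition plus_circle :: "circle \<Rightarrow> circle \<Rightarrow> circle" is "(+)"
  unfolding int_cong_def add_diff_add by (rule Ints_add)

lift_definition uminus_circle :: "circle \<Rightarrow> circle" is "uminus"
proof -
  fix a b :: real
  assume "int_cong a b"
  then have "int_cong b a"
    by (rule equivp_symp[OF equivp_int_cong])
  then show "int_cong (- a) (- b)"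
    by (simp add: int_cong_def)
qed

lift_definition minus_circle :: "circle \<Rightarrow> circle \<Rightarrow> circle" is "(-)"
proof -
  fix a b c d :: real
  assume "int_cong a b" "int_cong c d"
  then have "(a - b) - (c - d) \<in> \<int>"
    unfolding int_cong_def by (rule Ints_diff)
  also have "(a - b) - (c - d) = (a - c) - (b - d)"
    by simp
  finally show "int_cong (a - c) (b - d)"
    unfolding int_cong_def .
qed

instance
  by standard (transfer, simp add: int_cong_def algebra_simps)+

end

lemma to_circle_0: "to_circle 0 = 0"
  by transfer (simp add: int_cong_def)

lemma to_circle_add: "to_circle (x + y) = to_circle x + to_circle y"
  by transfer (simp add: int_cong_def)

text \<open>The topology is the quotient topology, so \<open>borel :: circle measure\<close>
  is the Borel \<open>\<sigma>\<close>-algebra of the circle.\<close>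

instantiation circle :: topological_space
begin

definition open_circle :: "circle set \<Rightarrow> bool" where
  "open_circle U \<longleftrightarrow> open (to_circle -` U)"

instance
  by standard (auto simp: open_circle_def vimage_Union vimage_Int)

end

lemma continuous_on_to_circle: "continuous_on A to_circle"
  by (rule continuous_on_subset[OF _ subset_UNIV])
     (simp add: continuous_on_open_vimage open_circle_def)

lemma continuous_on_circleI:
  fixes f :: "circle \<Rightarrow> 'a::topological_space"
  assumes "continuous_on UNIV (\<lambda>x. f (to_circle x))"
  shows "continuous_on UNIV f"
  using assms by (simp add: continuous_on_open_vimage open_circle_def vimage_def)

instance circle :: t1_space
proof
  fix s t :: circle
  assume "s \<noteq> t"
  obtain y where y: "t = to_circle y"
    by (cases t)
  have "to_circle -` {t} = (+) y ` \<int>"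
  proof (intro set_eqI iffI)
    fix x assume "x \<in> to_circle -` {t}"
    then have "x - y \<in> \<int>"
      by (simp add: y to_circle_eq_iff)
    then show "x \<in> (+) y ` \<int>"
      by (intro image_eqI[where x = "x - y"]) auto
  qed (auto simp: y to_circle_eq_iff)
  moreover have "closed ((+) y ` (\<int> :: real set))"
    by (intro closed_translation closed_Ints)
  ultimately have "open (- {t})"
    by (simp add: open_circle_def vimage_Compl open_Compl)
  with \<open>s \<noteq> t\<close> show "\<exists>U. open U \<and> s \<in> U \<and> t \<notin> U"
    by (intro exI[of _ "- {t}"]) auto
qed

lift_definition int_mult :: "int \<Rightarrow> circle \<Rightarrow> circle" is "\<lambda>k x. of_int k * x"
  unfolding int_cong_def right_diff_distrib[symmetric] by (rule Ints_mult[OF Ints_of_int])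

lemma int_mult_to_circle: "int_mult k (to_circle x) = to_circle (of_int k * x)"
  by transfer (simp add: int_cong_def)

lemma int_mult_1: "int_mult 1 t = t"
  by (cases t) (simp add: int_mult_to_circle)

lemma int_mult_add: "int_mult (k + l) t = int_mult k t + int_mult l t"
  by (cases t) (simp add: int_mult_to_circle to_circle_add distrib_right)

lemma Ints_nonempty: "(\<int> :: real set) \<noteq> {}"
  by (auto intro: Ints_0)

lemma infdist_Ints_add:
  fixes x k :: real
  assumes "k \<in> \<int>"
  shows "infdist (x + k) \<int> \<le> infdist x \<int>"
proof -
  have "infdist (x + k) \<int> \<le> dist x a" if "a \<in> \<int>" for a
    using infdist_le[of "a + k" \<int> "x + k"] that assms by (simp add: dist_real_def)
  then show ?thesis
    unfolding infdist_notempty[OF Ints_nonempty, of x]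
    by (intro cINF_greatest Ints_nonempty) auto
qed

lift_definition circle_norm :: "circle \<Rightarrow> real" is "\<lambda>x. infdist x \<int>"
proof -
  fix x y :: real
  assume "int_cong x y"
  moreover from this have "int_cong y x"
    by (rule equivp_symp[OF equivp_int_cong])
  ultimately have "x - y \<in> \<int>" "y - x \<in> \<int>"
    unfolding int_cong_def .
  then show "infdist x \<int> = infdist y \<int>"
    using infdist_Ints_add[of "x - y" y] infdist_Ints_add[of "y - x" x] by simp
qed

lemma circle_norm_to_circle: "circle_norm (to_circle x) = infdist x \<int>"
  by transfer simp

lemma circle_norm_round: "circle_norm (to_circle x) = \<bar>x - of_int (round x)\<bar>"
proof (rule antisym)
  show "circle_norm (to_circle x) \<le> \<bar>x - of_int (round x)\<bar>"
    using infdist_le[of "of_int (round x)" \<int> x]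
    by (simp add: circle_norm_to_circle dist_real_def)
  have "\<bar>x - of_int (round x)\<bar> \<le> dist x a" if "a \<in> \<int>" for a
    using that by (elim Ints_cases) (simp add: dist_real_def round_diff_minimal)
  then show "\<bar>x - of_int (round x)\<bar> \<le> circle_norm (to_circle x)"
    unfolding circle_norm_to_circle infdist_notempty[OF Ints_nonempty, of x]
    by (intro cINF_greatest Ints_nonempty) auto
qed

lemma continuous_on_circle_norm_int_mult:
  "continuous_on UNIV (\<lambda>t. circle_norm (int_mult k t))"
  by (rule continuous_on_circleI, unfold int_mult_to_circle circle_norm_to_circle)
     (intro continuous_intros)

lemma circle_norm_nonneg: "0 \<le> circle_norm t"
  by (cases t) (simp add: circle_norm_to_circle infdist_nonneg)

lemma circle_norm_le_half: "circle_norm t \<le> 1 / 2"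
  using of_int_round_abs_le
  by (cases t) (simp add: circle_norm_round abs_minus_commute)

text \<open>Consequently the Bochner integral of \<open>\<parallel>k \<theta>\<parallel>\<close> is never the default
  value for non-integrable functions.\<close>

lemma integrable_circle_norm:
  assumes "prob_space M" "sets M = sets (borel :: circle measure)"
  shows "integrable M (\<lambda>t. circle_norm (int_mult k t))"
proof -
  interpret prob_space M by fact
  have "(\<lambda>t. circle_norm (int_mult k t)) \<in> borel_measurable borel"
    by (intro borel_measurable_continuous_onI continuous_on_circle_norm_int_mult)
  then have "(\<lambda>t. circle_norm (int_mult k t)) \<in> borel_measurable M"
    by (simp add: measurable_cong_sets[OF assms(2) refl])
  then show ?thesis
    by (intro integrable_const_bound[of _ "1 / 2"] AE_I2)
       (simp_all only: real_norm_def abs_of_nonneg circle_norm_nonneg circle_norm_le_half)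
qed

text \<open>Families are indexed by the positive integers; \<open>\<alpha> 0\<close> plays no role.\<close>

definition rationally_independent :: "(nat \<Rightarrow> circle) \<Rightarrow> bool" where
  "rationally_independent \<alpha> \<longleftrightarrow>
     (\<forall>n. \<forall>k :: nat \<Rightarrow> int.
        (\<Sum>i = 1..n. int_mult (k i) (\<alpha> i)) = 0 \<longrightarrow> (\<forall>i \<in> {1..n}. k i = 0))"

end

theory Submission
  imports Defs
begin

text \<open>
  Lift \<open>\<alpha> (i + 1)\<close> to an irrational real \<open>a i\<close>. Hypothesis (b) is inherited by points
  \<open>x i = c i * a i + k i\<close> with integers \<open>c i\<close>, \<open>k i\<close>, and these can be placed anywhere up to an
  arbitrarily small error. Choose them one at a time, \<open>x (j + 1)\<close> next to a parent among
  \<open>x 0, \<dots>, x j\<close>, so close that multiplication by \<open>m n\<close> does not separate the two for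
  \<open>n < T j\<close>, where \<open>T j\<close> is a time after which at most one of \<open>m n * x 0, \<dots>, m n * x j\<close> is far
  from \<open>\<int>\<close>. The parents come from successively cutting \<open>[0, 1)\<close> at a dense sequence: the
  step functions sending the cell with index \<open>i\<close> to \<open>x i\<close> converge, and the measure is the
  distribution of the limit. For \<open>T j \<le> n < T (j + 1)\<close>, the integral is small since at most two of the
  cells \<open>0, \<dots>, j + 1\<close>, all of small length, are bad: the exceptional one, and the new one, for
  which \<open>m n * x (j + 1)\<close> is not yet controlled. Keeping the neighbourhoods of the \<open>x i\<close>
  disjoint puts each fibre of the limit inside arbitrarily short cells, so there are no atoms.
\<close>

section \<open>Distance to the integers\<close>

lemma infdist_Ints_round: "infdist x \<int> = \<bar>x - of_int (round x)\<bar>"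
  using circle_norm_round circle_norm_to_circle by simp

text \<open>If \<open>e\<close> is the signed offset of \<open>k * x\<close> from its nearest
  integer, then \<open>k * (c * x + l)\<close> is an integer plus \<open>c * e\<close>. So
  hypothesis (b) passes from \<open>a i\<close> to \<open>x i\<close> at the cost of a constant
  factor.\<close>

lemma infdist_Ints_int_combination_le:
  fixes x :: real and k c l :: int
  shows "infdist (of_int k * (of_int c * x + of_int l)) \<int> \<le> \<bar>of_int c\<bar> * infdist (of_int k * x) \<int>"
proof -
  define e where "e = of_int k * x - of_int (round (of_int k * x))"
  have "of_int k * (of_int c * x + of_int l)
      = of_int (c * round (of_int k * x) + k * l) + of_int c * e"
    by (simp add: e_def algebra_simps)
  then have "infdist (of_int k * (of_int c * x + of_int l)) \<int> \<le> \<bar>of_int c * e\<bar>"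
    using infdist_le[of "of_int (c * round (of_int k * x) + k * l)" \<int>
        "of_int k * (of_int c * x + of_int l)"]
    by (simp add: dist_real_def)
  then show ?thesis
    by (simp add: abs_mult infdist_Ints_round e_def)
qed

text \<open>For \<open>x = p / q\<close> the single coefficient \<open>q\<close> at index
  \<open>i\<close> would be a nontrivial relation.\<close>

lemma irrational_of_rationally_independent:
  assumes "rationally_independent \<alpha>" and "i \<ge> 1" and "\<alpha> i = to_circle x"
  shows "x \<notin> \<rat>"
proof
  assume "x \<in> \<rat>"
  then obtain p q :: int where pq: "q > 0" "x = of_int p / of_int q"
    by (meson Rats_cases')
  define k where "k = (\<lambda>j. if j = i then q else 0)"
  have "int_mult 0 t = 0" for t
    by (cases t) (simp add: int_mult_to_circle to_circle_0)
  then have "(\<Sum>j = 1..i. int_mult (k j) (\<alpha> j)) = (\<Sum>j\<in>{i}. int_mult (k j) (\<alpha> j))"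
    using \<open>i \<ge> 1\<close> by (intro sum.mono_neutral_right) (auto simp: k_def)
  also have "\<dots> = to_circle (of_int p)"
    using pq by (simp add: k_def assms(3) int_mult_to_circle)
  also have "\<dots> = 0"
    by (simp flip: to_circle_0 add: to_circle_eq_iff)
  finally have "k i = 0"
    using assms(1,2) unfolding rationally_independent_def by (metis atLeastAtMost_iff order_refl)
  with pq show False
    by (simp add: k_def)
qed

text \<open>Removing \<open>F\<close> from the target interval leaves a nonempty open set, and
  density is applied to a small ball inside it.\<close>

lemma real_multiples_dense_avoiding:
  fixes a y d :: real
  assumes "a \<notin> \<rat>" and "d > 0" and "finite F"
  obtains c k :: int where "\<bar>of_int c * a + of_int k - y\<bar> < d" "of_int c * a + of_int k \<notin> F"
proof -
  have "infinite ({y - d<..<y + d} - F)"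
    using assms by (intro Diff_infinite_finite infinite_Ioo) auto
  then obtain z where z: "z \<in> {y - d<..<y + d} - F"
    using infinite_imp_nonempty by blast
  have "open ({y - d<..<y + d} - F)"
    using assms(3) by (intro open_Diff finite_imp_closed) auto
  then obtain e where e: "e > 0" "ball z e \<subseteq> {y - d<..<y + d} - F"
    using z unfolding open_contains_ball by blast
  obtain h c :: int where "\<bar>of_int c * a - of_int h - z\<bar> < e"
    using sequence_of_fractional_parts_is_dense[OF assms(1) e(1), of z] by metis
  then have "of_int c * a + of_int (- h) \<in> ball z e"
    by (simp add: dist_real_def abs_minus_commute)
  with e(2) have "of_int c * a + of_int (- h) \<in> {y - d<..<y + d} - F"
    by blast
  then show ?thesis
    by (intro that[of c "- h"]) auto
qed

section \<open>Construction of the points\<close>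

text \<open>The gap \<open>2 * r\<close> keeps the closed \<open>r\<close>-balls around the points
  disjoint; descendants of a point will stay in its ball. The bound \<open>(1/2) ^ (j + 3)\<close>
  sends the radii to 0 and starts them at most at 1/8, so that no two limit points differ by a
  nonzero integer. A value \<open>b > j\<close> means that no index is exceptional.\<close>

definition stage :: "(nat \<Rightarrow> real) \<Rightarrow> (nat \<Rightarrow> nat) \<Rightarrow> nat \<Rightarrow> (nat \<Rightarrow> real) \<Rightarrow> nat \<Rightarrow> real \<Rightarrow> bool" where
  "stage a m j x T r \<longleftrightarrow>
     0 < r \<and> r \<le> (1/2) ^ (j + 3) \<and>
     (\<forall>i\<le>j. \<exists>c k :: int. x i = of_int c * a i + of_int k) \<and>
     (\<forall>i\<le>j. \<forall>i'\<le>j. i \<noteq> i' \<longrightarrow> 2 * r < \<bar>x i - x i'\<bar>) \<and>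
     (\<forall>n<T. real (m n) * r \<le> (1/2) ^ j) \<and>
     (\<forall>n\<ge>T. \<exists>b. \<forall>i\<le>j. i \<noteq> b \<longrightarrow> infdist (real (m n) * x i) \<int> < (1/2) ^ j)"

lemma finite_positive_lower_bound:
  fixes A :: "real set"
  assumes "finite A" and "\<And>y. y \<in> A \<Longrightarrow> 0 < y"
  obtains r where "0 < r" "\<And>y. y \<in> A \<Longrightarrow> r < y"
proof -
  have "0 < Min (insert 1 A)"
    using assms by (subst Min_gr_iff) auto
  moreover have "Min (insert 1 A) \<le> y" if "y \<in> A" for y
    using assms(1) that by simp
  ultimately show ?thesis
    by (intro that[of "Min (insert 1 A) / 2"]) force+
qed

text \<open>\<open>T\<close> is fixed before \<open>r\<close>, because \<open>r\<close> must be
  small against the finitely many \<open>m n\<close> with \<open>n < T\<close>.\<close>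

lemma stage_exists:
  assumes b: "\<And>\<epsilon> k. 0 < \<epsilon> \<Longrightarrow>
      \<exists>N. \<forall>n\<ge>N. \<exists>b. \<forall>i<k. i \<noteq> b \<longrightarrow> infdist (real (m n) * a i) \<int> < \<epsilon>"
    and inj: "inj_on x {..j}"
    and comb: "\<And>i. i \<le> j \<Longrightarrow> \<exists>c k :: int. x i = of_int c * a i + of_int k"
    and "0 < R"
  obtains T r where "T > T0" "r \<le> R" "stage a m j x T r"
proof -
  obtain c k where ck: "\<And>i. i \<le> j \<Longrightarrow> x i = of_int (c i) * a i + of_int (k i :: int)"
    using comb by metis
  \<comment> \<open>\<open>C\<close> dominates all coefficients and is positive thanks to the
    summand 1; tolerance \<open>(1/2) ^ j / C\<close> for \<open>a i\<close> then yields
    \<open>(1/2) ^ j\<close> for \<open>x i\<close>.\<close>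
  define C where "C = 1 + (\<Sum>i\<le>j. \<bar>real_of_int (c i)\<bar>)"
  have "C > 0"
    unfolding C_def by (smt (verit) sum_nonneg abs_ge_zero)
  have c_le: "\<bar>real_of_int (c i)\<bar> \<le> C" if "i \<le> j" for i
    using member_le_sum[of i "{..j}" "\<lambda>i. \<bar>real_of_int (c i)\<bar>"] that by (simp add: C_def)
  obtain N where N: "\<And>n. n \<ge> N \<Longrightarrow>
      \<exists>b. \<forall>i<Suc j. i \<noteq> b \<longrightarrow> infdist (real (m n) * a i) \<int> < (1/2) ^ j / C"
    using b[of "(1/2) ^ j / C" "Suc j"] \<open>C > 0\<close> by auto
  define T where "T = max N (Suc T0)"
  have late: "\<exists>b. \<forall>i\<le>j. i \<noteq> b \<longrightarrow> infdist (real (m n) * x i) \<int> < (1/2) ^ j" if "n \<ge> T" for n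
  proof -
    obtain b where b: "\<And>i. i \<le> j \<Longrightarrow> i \<noteq> b \<Longrightarrow> infdist (real (m n) * a i) \<int> < (1/2) ^ j / C"
      using N[of n] \<open>n \<ge> T\<close> by (auto simp: T_def less_Suc_eq_le)
    have "infdist (real (m n) * x i) \<int> < (1/2) ^ j" if "i \<le> j" "i \<noteq> b" for i
    proof -
      have "infdist (real (m n) * x i) \<int> \<le> \<bar>of_int (c i)\<bar> * infdist (real (m n) * a i) \<int>"
        using infdist_Ints_int_combination_le[of "int (m n)" "c i" "a i" "k i"] ck[OF that(1)]
        by simp
      also have "\<dots> \<le> C * infdist (real (m n) * a i) \<int>"
        by (intro mult_right_mono c_le that infdist_nonneg)
      also have "\<dots> < (1/2) ^ j"
        using b[OF that] \<open>C > 0\<close> by (simp add: field_simps)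
      finally show ?thesis .
    qed
    then show ?thesis
      by blast
  qed
  \<comment> \<open>All upper bounds wanted for \<open>r\<close>: injectivity of \<open>x\<close>
    makes the halved gaps positive, and \<open>1 + real (m n)\<close> avoids division by
    zero.\<close>
  define A where "A = {R, (1/2) ^ (j + 3)}
      \<union> (\<lambda>(i, i'). \<bar>x i - x i'\<bar> / 2) ` {(i, i') \<in> {..j} \<times> {..j}. i \<noteq> i'}
      \<union> (\<lambda>n. (1/2) ^ j / (1 + real (m n))) ` {..<T}"
  have "finite {(i, i') \<in> {..j} \<times> {..j}. i \<noteq> i'}"
    by (rule finite_subset[of _ "{..j} \<times> {..j}"]) auto
  then have "finite A"
    by (auto simp: A_def)
  moreover have "0 < y" if "y \<in> A" for y
    using that \<open>0 < R\<close> inj_onD[OF inj] by (fastforce simp: A_def add_pos_nonneg)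
  ultimately obtain r where "0 < r" and r: "\<And>y. y \<in> A \<Longrightarrow> r < y"
    using finite_positive_lower_bound by blast
  have sep: "2 * r < \<bar>x i - x i'\<bar>" if "i \<le> j" "i' \<le> j" "i \<noteq> i'" for i i'
    using r[of "\<bar>x i - x i'\<bar> / 2"] that by (force simp: A_def)
  have early: "real (m n) * r \<le> (1/2) ^ j" if "n < T" for n
  proof -
    have "r < (1/2) ^ j / (1 + real (m n))"
      using that by (intro r) (auto simp: A_def)
    then have "r * (1 + real (m n)) < (1/2) ^ j"
      by (subst (asm) pos_less_divide_eq) (auto simp: add_pos_nonneg)
    with \<open>0 < r\<close> show ?thesis
      by (simp add: algebra_simps)
  qed
  have "r < R" "r < (1/2) ^ (j + 3)"
    by (rule r, simp add: A_def)+
  then have "stage a m j x T r"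
    unfolding stage_def using \<open>0 < r\<close> comb sep early late by auto
  moreover have "T > T0"
    by (simp add: T_def)
  ultimately show ?thesis
    using that[of T r] \<open>r < R\<close> by simp
qed

lemma stage_cong: "stage a m j x T r \<longleftrightarrow> stage a m j y T r" if "\<And>i. i \<le> j \<Longrightarrow> x i = y i"
  unfolding stage_def using that by auto

text \<open>Dependent choice, with \<open>\<pi>\<close> naming the parent. Offsets of at most
  \<open>r j / 2\<close> together with halving radii limit the total drift along a line of descent
  from stage \<open>j\<close> on to \<open>r j\<close>.\<close>

lemma stage_sequence:
  assumes irr: "\<And>i. a i \<notin> \<rat>"
    and b: "\<And>\<epsilon> k. 0 < \<epsilon> \<Longrightarrow>
      \<exists>N. \<forall>n\<ge>N. \<exists>b. \<forall>i<k. i \<noteq> b \<longrightarrow> infdist (real (m n) * a i) \<int> < \<epsilon>"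
    and \<pi>: "\<And>j. \<pi> (Suc j) \<le> j"
  obtains x T r where "strict_mono T" "\<And>j. stage a m j x (T j) (r j)"
    "\<And>j. \<bar>x (Suc j) - x (\<pi> (Suc j))\<bar> \<le> r j / 2" "\<And>j. r (Suc j) \<le> r j / 2"
proof -
  define P where "P = (\<lambda>j (x, T, r). stage a m j x T r)"
  define Q where "Q = (\<lambda>j (x, T :: nat, r) (x', T', r').
      T < T' \<and> r' \<le> r / 2 \<and> (\<forall>i\<le>j. x' i = x i) \<and> \<bar>x' (Suc j) - x (\<pi> (Suc j))\<bar> \<le> (r :: real) / 2)"
  have "\<exists>s. P 0 s"
  proof -
    have "\<exists>c k :: int. (0 :: real) = of_int c * a i + of_int k" for i
      by (intro exI[of _ 0]) simp
    then obtain T r where "stage a m 0 (\<lambda>_. 0) T r"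
      using stage_exists[OF b, of "\<lambda>_. 0" 0 1] by (force simp: inj_on_def)
    then show ?thesis
      by (auto simp: P_def)
  qed
  moreover have "\<exists>s'. P (Suc j) s' \<and> Q j s s'" if P: "P j s" for j s
  proof -
    obtain x T r where s: "s = (x, T, r)"
      by (cases s)
    have st: "stage a m j x T r"
      using P by (simp add: P_def s)
    then have "0 < r"
      by (simp add: stage_def)
    \<comment> \<open>Avoiding the old points keeps the extended family injective, as
      \<open>stage_exists\<close> requires.\<close>
    obtain c k :: int where ck: "\<bar>of_int c * a (Suc j) + of_int k - x (\<pi> (Suc j))\<bar> < r / 2"
      "of_int c * a (Suc j) + of_int k \<notin> x ` {..j}"
      by (rule real_multiples_dense_avoiding[OF irr[of "Suc j"] half_gt_zero[OF \<open>0 < r\<close>],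
            where F = "x ` {..j}" and y = "x (\<pi> (Suc j))"]) auto
    define x' where "x' = x(Suc j := of_int c * a (Suc j) + of_int k)"
    have "2 * r < \<bar>x i - x i'\<bar>" if "i \<le> j" "i' \<le> j" "i \<noteq> i'" for i i'
      using st that unfolding stage_def by blast
    with \<open>0 < r\<close> have "x i \<noteq> x i'" if "i \<le> j" "i' \<le> j" "i \<noteq> i'" for i i'
      using that by fastforce
    then have "inj_on x {..j}"
      by (auto intro: inj_onI)
    then have "inj_on x' {..j}"
      by (rule inj_on_cong[THEN iffD1, rotated]) (simp add: x'_def)
    moreover have "x' ` {..j} = x ` {..j}" "{..j} - {Suc j} = {..j}"
      by (auto simp: x'_def)
    ultimately have "inj_on x' {..Suc j}"
      using ck(2) by (simp add: atMost_Suc x'_def del: fun_upd_image)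
    moreover have "\<exists>c k :: int. x' i = of_int c * a i + of_int k" if "i \<le> Suc j" for i
      using st that by (auto simp: x'_def stage_def)
    ultimately obtain T' r' where "T < T'" "r' \<le> r / 2" "stage a m (Suc j) x' T' r'"
      using stage_exists[OF b, of x' "Suc j" "r / 2" T] \<open>0 < r\<close> by auto
    then have "P (Suc j) (x', T', r') \<and> Q j s (x', T', r')"
      using ck(1) by (auto simp: P_def Q_def s x'_def)
    then show ?thesis
      by blast
  qed
  ultimately obtain f where f: "\<And>j. P j (f j)" "\<And>j. Q j (f j) (f (Suc j))"
    using dependent_nat_choice[of P Q] by blast
  define y where "y = (\<lambda>j. fst (f j))"
  define T where "T = (\<lambda>j. fst (snd (f j)))"
  define r where "r = (\<lambda>j. snd (snd (f j)))"
  \<comment> \<open>Later stages never change the entries up to \<open>j\<close>, so the diagonal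
    agrees with \<open>y j\<close> there.\<close>
  define x where "x = (\<lambda>j. y j j)"
  have st: "stage a m j (y j) (T j) (r j)" for j
    using f(1)[of j] by (simp add: P_def y_def T_def r_def split_beta)
  have step: "T j < T (Suc j)" "r (Suc j) \<le> r j / 2" "\<And>i. i \<le> j \<Longrightarrow> y (Suc j) i = y j i"
    "\<bar>y (Suc j) (Suc j) - y j (\<pi> (Suc j))\<bar> \<le> r j / 2" for j
    using f(2)[of j] by (auto simp: Q_def y_def T_def r_def split_beta)
  have x: "y j i = x i" if "i \<le> j" for i j
    using that by (induction j rule: dec_induct) (simp_all add: x_def step(3))
  show ?thesis
  proof
    show "strict_mono T"
      by (simp add: strict_mono_Suc_iff step(1))
    show "stage a m j x (T j) (r j)" for j
      using st[of j] stage_cong[of j "y j" x] x by simp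
    show "\<bar>x (Suc j) - x (\<pi> (Suc j))\<bar> \<le> r j / 2" for j
      using step(4)[of j] x[OF \<pi>] x[of "Suc j" "Suc j"] by simp
    show "r (Suc j) \<le> r j / 2" for j
      by (rule step(2))
  qed
qed

section \<open>Refining partitions of the unit interval\<close>

text \<open>The points \<open>v 0, \<dots>, v j\<close> cut \<open>[0, 1)\<close> into half-open intervals; \<open>cell v j t\<close> is the index of
  the left endpoint of the interval containing \<open>t\<close>.\<close>

fun cell :: "(nat \<Rightarrow> real) \<Rightarrow> nat \<Rightarrow> real \<Rightarrow> nat" where
  "cell v 0 t = 0"
| "cell v (Suc j) t = (if v (cell v j t) < v (Suc j) \<and> v (Suc j) \<le> t then Suc j else cell v j t)"

lemma cell_le: "cell v j t \<le> j"
  by (induction j) auto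

lemma cell_lower: "v 0 \<le> t \<Longrightarrow> v (cell v j t) \<le> t"
  by (induction j) auto

lemma cell_greatest: "i \<le> j \<Longrightarrow> v i \<le> t \<Longrightarrow> v i \<le> v (cell v j t)"
  by (induction j) (auto simp: le_Suc_eq)

lemma cell_cong:
  assumes "\<And>i. i \<le> j \<Longrightarrow> v i \<le> t \<longleftrightarrow> v i \<le> s"
  shows "cell v j t = cell v j s"
  using assms by (induction j) auto

text \<open>The new cut point lies between the left endpoint of the old cell of \<open>t\<close> and
  \<open>t\<close> itself, and no earlier cut point separates it from \<open>t\<close>. Hence all
  \<open>t\<close> entering the new cell come from one parent, independent of
  \<open>t\<close>.\<close>

lemma cell_Suc_eq_Suc:
  assumes "v 0 \<le> t" and "cell v (Suc j) t = Suc j"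
  shows "cell v j t = cell v j (v (Suc j))"
proof (rule cell_cong)
  have t: "v (cell v j t) < v (Suc j)" "v (Suc j) \<le> t"
    using assms(2) cell_le[of v j t] by (auto split: if_splits)
  fix i assume "i \<le> j"
  then show "v i \<le> t \<longleftrightarrow> v i \<le> v (Suc j)"
    using t cell_greatest[of i j v t] by linarith
qed

lemma measurable_cell [measurable]: "cell v j \<in> borel \<rightarrow>\<^sub>M count_space UNIV"
proof (induction j)
  case (Suc j)
  note [measurable] = Suc
  have "(\<lambda>t. v (cell v j t)) \<in> borel_measurable borel"
    by measurable
  then show ?case
    by simp
qed simp


text \<open>Take a grid of spacing \<open>1 / M\<close> with \<open>2 / M < \<epsilon>\<close> and
  one cut point inside each grid interval. Once these are present, the cut point in the grid
  interval preceding that of \<open>t\<close> is within \<open>2 / M\<close> of \<open>t\<close>;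
  for the first interval \<open>v 0 = 0\<close> serves.\<close>

lemma cell_mesh:
  assumes v0: "v 0 = 0" and dense: "\<And>a b :: real. a < b \<Longrightarrow> \<exists>i. a < v i \<and> v i < b" and "\<epsilon> > 0"
  obtains J where "\<And>j t. j \<ge> J \<Longrightarrow> 0 \<le> t \<Longrightarrow> t < 1 \<Longrightarrow> t < v (cell v j t) + \<epsilon>"
proof -
  obtain M :: nat where M: "M > 0" "2 / real M < \<epsilon>"
    using reals_Archimedean2[of "2 / \<epsilon>"] \<open>\<epsilon> > 0\<close>
    by (metis divide_pos_pos gr0I less_asym of_nat_0 pos_divide_less_eq mult.commute zero_less_numeral
        of_nat_0_less_iff)
  have "\<exists>i. real k / M < v i \<and> v i < real (Suc k) / M" for k
    using M by (intro dense divide_strict_right_mono) auto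
  then obtain g where g: "\<And>k. real k / M < v (g k)" "\<And>k. v (g k) < real (Suc k) / M"
    by metis
  show ?thesis
  proof
    fix j t
    assume j: "j \<ge> Max (g ` {..<M})" and t: "0 \<le> t" "t < (1 :: real)"
    define k where "k = nat \<lfloor>t * M\<rfloor>"
    have k: "real k \<le> t * M" "t * M < real k + 1"
      using t by (auto simp: k_def)
    have "t * M < M"
      using t M by simp
    show "t < v (cell v j t) + \<epsilon>"
    proof (cases k)
      case 0
      then have "t < 1 / M"
        using k M by (simp add: field_simps)
      also have "\<dots> \<le> 2 / M"
        by (simp add: divide_right_mono)
      finally show ?thesis
        using cell_greatest[of 0 j v t] M t v0 by simp
    next
      case (Suc l)
      then have "l < M"
        using k(1) \<open>t * M < M\<close> by linarith
      then have "g l \<le> Max (g ` {..<M})"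
        by simp
      moreover have "real (Suc l) / M \<le> t" "t < real l / M + 2 / M"
        using k Suc M by (simp_all add: field_simps)
      ultimately show ?thesis
        using cell_greatest[of "g l" j v t] j g[of l] M(2) by linarith
    qed
  qed
qed

lemma dense_real_sequence:
  obtains v :: "nat \<Rightarrow> real" where "v 0 = 0" "\<And>a b. a < b \<Longrightarrow> \<exists>i. a < v i \<and> v i < b"
proof
  \<comment> \<open>The value 0 recurs among the rationals; the strict inequality in
    \<open>cell\<close> makes repeated and negative cut points idle.\<close>
  define v :: "nat \<Rightarrow> real" where "v = case_nat 0 (\<lambda>k. of_rat (from_nat k))"
  show "v 0 = 0"
    by (simp add: v_def)
  fix a b :: real
  assume "a < b"
  then obtain q where q: "a < of_rat q" "of_rat q < b"
    using of_rat_dense by blast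
  then show "\<exists>i. a < v i \<and> v i < b"
    by (intro exI[of _ "Suc (to_nat q)"]) (simp add: v_def)
qed

section \<open>The limit measure\<close>

abbreviation uniform_unit :: "real measure" where
  "uniform_unit \<equiv> uniform_measure lborel {0..<1}"

lemma prob_space_uniform_unit: "prob_space uniform_unit"
  by (rule prob_space_uniform_measure) auto

lemma AE_uniform_unit: "AE t in uniform_unit. 0 \<le> t \<and> t < 1"
  by (simp add: AE_uniform_measure)

text \<open>The geometric content of \<open>stage\<close>, freed from the times \<open>T\<close> and
  the multipliers \<open>m n\<close>.\<close>

locale refining_points =
  fixes v :: "nat \<Rightarrow> real" and x :: "nat \<Rightarrow> real" and r :: "nat \<Rightarrow> real"
  assumes v_0: "v 0 = 0"
    and v_dense: "\<And>a b. a < b \<Longrightarrow> \<exists>i. a < v i \<and> v i < b"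
    and r_le: "r j \<le> (1/2) ^ (j + 3)"
    and r_Suc: "r (Suc j) \<le> r j / 2"
    and r_pos: "0 < r j"
    and x_sep: "i \<le> j \<Longrightarrow> i' \<le> j \<Longrightarrow> i \<noteq> i' \<Longrightarrow> 2 * r j < \<bar>x i - x i'\<bar>"
    and x_near_parent: "\<bar>x (Suc j) - x (cell v j (v (Suc j)))\<bar> \<le> r j / 2"
begin

definition point :: "real \<Rightarrow> real" where
  "point t = lim (\<lambda>j. x (cell v j t))"

lemma point_measurable [measurable]: "point \<in> borel_measurable borel"
  unfolding point_def by (rule borel_measurable_lim_metric) measurable

lemma point_near:
  assumes "0 \<le> t"
  shows "\<bar>point t - x (cell v j t)\<bar> \<le> r j"
proof -
  define y where "y = (\<lambda>j. x (cell v j t))"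
  have step: "\<bar>y (Suc j) - y j\<bar> \<le> r j / 2" for j
  proof (cases "cell v (Suc j) t = Suc j")
    case True
    moreover have "cell v j t = cell v j (v (Suc j))"
      by (rule cell_Suc_eq_Suc) (use True assms v_0 in \<open>simp_all only:\<close>)
    ultimately show ?thesis
      unfolding y_def by (simp only: x_near_parent)
  next
    case False
    then have "cell v (Suc j) t = cell v j t"
      by (auto split: if_splits)
    then show ?thesis
      using r_pos[of j] by (simp add: y_def)
  qed
  \<comment> \<open>Telescoping: \<open>r (Suc j) \<le> r j / 2\<close> gives
    \<open>r j / 2 \<le> r j - r (Suc j)\<close>.\<close>
  have near: "\<bar>y (j + k) - y j\<bar> \<le> r j - r (j + k)" for j k
  proof (induction k)
    case (Suc k)
    then show ?case
      using step[of "j + k"] r_Suc[of "j + k"] unfolding add_Suc_right by linarith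
  qed simp
  have near': "\<bar>y i - y j\<bar> \<le> r j" if "j \<le> i" for i j
    using near[of j "i - j"] r_pos[of i] that by simp
  have "r \<longlonglongrightarrow> 0"
  proof (rule Lim_null_comparison)
    have "r j \<le> (1/2) ^ j" for j
      by (rule order_trans[OF r_le power_decreasing]) auto
    then show "eventually (\<lambda>j. norm (r j) \<le> (1/2) ^ j) sequentially"
      using r_pos by (simp add: less_imp_le)
    show "(\<lambda>j. (1/2 :: real) ^ j) \<longlonglongrightarrow> 0"
      by (rule LIMSEQ_realpow_zero) auto
  qed
  have "Cauchy y"
  proof (rule metric_CauchyI)
    fix e :: real
    assume "e > 0"
    then have "eventually (\<lambda>j. r j < e / 2) sequentially"
      using order_tendstoD(2)[OF \<open>r \<longlonglongrightarrow> 0\<close>, of "e / 2"] by simp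
    then obtain j where "r j < e / 2"
      by (auto simp: eventually_sequentially)
    moreover have "dist (y i) (y n) \<le> r j + r j" if "i \<ge> j" "n \<ge> j" for i n
      using near'[of j i] near'[of j n] that unfolding dist_real_def by linarith
    ultimately show "\<exists>M. \<forall>i\<ge>M. \<forall>n\<ge>M. dist (y i) (y n) < e"
      by (intro exI[of _ j]) fastforce
  qed
  then have "y \<longlonglongrightarrow> point t"
    by (simp add: point_def y_def Cauchy_convergent_iff convergent_LIMSEQ_iff)
  then have "(\<lambda>i. \<bar>y i - y j\<bar>) \<longlonglongrightarrow> \<bar>point t - y j\<bar>"
    by (intro tendsto_intros)
  then have "\<bar>point t - y j\<bar> \<le> r j"
    by (rule LIMSEQ_le_const2) (use near' in blast)
  then show ?thesis
    by (simp add: y_def)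
qed

lemma prob_cell:
  assumes "\<epsilon> > 0"
  obtains J where "\<And>j i. j \<ge> J \<Longrightarrow> measure uniform_unit {t. cell v j t = i} \<le> \<epsilon>"
proof -
  obtain J where J: "\<And>j t. j \<ge> J \<Longrightarrow> 0 \<le> t \<Longrightarrow> t < 1 \<Longrightarrow> t < v (cell v j t) + \<epsilon>"
    using cell_mesh[OF v_0 v_dense assms] by blast
  have "measure uniform_unit {t. cell v j t = i} \<le> \<epsilon>" if "j \<ge> J" for i j
  proof -
    have [measurable]: "{t. cell v j t = i} \<in> sets borel"
      by measurable
    have "measure uniform_unit {t. cell v j t = i}
        = measure lborel ({0..<1} \<inter> {t. cell v j t = i})"
      by (subst measure_uniform_measure) auto
    also have "\<dots> \<le> measure lborel {v i..v i + \<epsilon>}"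
    proof (rule measure_mono_fmeasurable)
      show "{0..<1} \<inter> {t. cell v j t = i} \<subseteq> {v i..v i + \<epsilon>}"
        using J[OF that] cell_lower[of v _ j] v_0 by force
    next
      show "{v i..v i + \<epsilon>} \<in> fmeasurable lborel"
        by (rule fmeasurableI) (use assms in auto)
    qed auto
    also have "\<dots> = \<epsilon>"
      using assms by simp
    finally show ?thesis .
  qed
  then show ?thesis
    using that by blast
qed

lemma cell_eq_if_same_circle_point:
  assumes "0 \<le> s" "0 \<le> t" and "to_circle (point s) = to_circle (point t)"
  shows "cell v j s = cell v j t"
proof (rule ccontr)
  assume "cell v j s \<noteq> cell v j t"
  \<comment> \<open>At stage 0 there is one cell, so both limit points are within \<open>r 0\<close>
    of \<open>x 0\<close>; congruence mod 1 thus becomes equality of reals.\<close>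
  have "r 0 \<le> 1 / 8"
    using r_le[of 0] by (simp add: power3_eq_cube)
  then have "\<bar>point s - point t\<bar> < 1"
    using point_near[of s 0] point_near[of t 0] assms by simp
  then have "point s = point t"
    using assms(3) Ints_nonzero_abs_less1[of "point s - point t"]
    by (simp add: to_circle_eq_iff)
  then have "\<bar>x (cell v j s) - x (cell v j t)\<bar> \<le> 2 * r j"
    using point_near[of s j] point_near[of t j] assms by simp
  with x_sep[OF cell_le cell_le \<open>cell v j s \<noteq> cell v j t\<close>] show False
    by simp
qed

section \<open>The distribution on the circle: no atoms, and bounds for the integrals\<close>

definition law :: "circle measure" where
  "law = distr uniform_unit borel (\<lambda>t. to_circle (point t))"

lemma to_circle_point_measurable [measurable]:
  "(\<lambda>t. to_circle (point t)) \<in> borel_measurable borel"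
  using borel_measurable_continuous_onI[OF continuous_on_to_circle] by measurable

lemma prob_space_law: "prob_space law"
  unfolding law_def by (intro prob_space.prob_space_distr prob_space_uniform_unit) simp

lemma sets_law: "sets law = sets borel"
  by (simp add: law_def)

text \<open>By \<open>cell_eq_if_same_circle_point\<close> the nonnegative part of a fibre lies in a
  single cell at every stage, and \<open>prob_cell\<close> makes that cell arbitrarily
  small.\<close>

lemma law_continuous: "emeasure law {y} = 0"
proof -
  interpret prob_space uniform_unit
    by (rule prob_space_uniform_unit)
  define A where "A = {t. to_circle (point t) = y}"
  have [measurable]: "A \<in> sets borel"
    using measurable_sets[OF to_circle_point_measurable, of "{y}"] by (simp add: A_def vimage_def)
  have "measure uniform_unit A \<le> \<epsilon>" if pos: "\<epsilon> > 0" for \<epsilon>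
  proof (cases "\<exists>s\<ge>0. s \<in> A")
    case True
    then obtain s where s: "s \<ge> 0" "s \<in> A"
      by blast
    obtain j where "\<And>j' i. j' \<ge> j \<Longrightarrow> measure uniform_unit {t. cell v j' t = i} \<le> \<epsilon>"
      by (rule prob_cell[OF pos]) blast
    then have j: "measure uniform_unit {t. cell v j t = i} \<le> \<epsilon>" for i
      by simp
    have sub: "t \<in> {t. cell v j t = cell v j s}" if "0 \<le> t" "t \<in> A" for t
      unfolding mem_Collect_eq
      by (rule cell_eq_if_same_circle_point) (use s that in \<open>auto simp: A_def\<close>)
    have "AE t in uniform_unit. t \<in> A \<longrightarrow> t \<in> {t. cell v j t = cell v j s}"
      using AE_uniform_unit by eventually_elim (use sub in blast)
    then have "measure uniform_unit A \<le> measure uniform_unit {t. cell v j t = cell v j s}"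
      by (intro finite_measure_mono_AE) auto
    with j show ?thesis
      using order_trans by blast
  next
    case False
    have "AE t in uniform_unit. t \<in> A \<longrightarrow> t \<in> {}"
      using AE_uniform_unit by eventually_elim (use False in auto)
    then have "measure uniform_unit A \<le> measure uniform_unit {}"
      by (intro finite_measure_mono_AE) auto
    with pos show ?thesis
      by simp
  qed
  then have "measure uniform_unit A \<le> 0"
    by (rule field_le_epsilon) simp
  then have "emeasure uniform_unit A = 0"
    by (simp add: emeasure_eq_measure measure_le_0_iff)
  then show ?thesis
    unfolding law_def by (subst emeasure_distr) (auto simp: A_def vimage_def)
qed

lemma integral_law:
  "(\<integral>\<theta>. circle_norm (int_mult k \<theta>) \<partial>law) = (\<integral>t. infdist (of_int k * point t) \<int> \<partial>uniform_unit)"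
proof -
  have "(\<lambda>\<theta>. circle_norm (int_mult k \<theta>)) \<in> borel_measurable borel"
    by (intro borel_measurable_continuous_onI continuous_on_circle_norm_int_mult)
  then show ?thesis
    unfolding law_def
    by (subst integral_distr) (simp_all add: int_mult_to_circle circle_norm_to_circle)
qed

text \<open>In the window between the times attached to the stages \<open>j\<close> and \<open>Suc j\<close> only the new point
  \<open>x (Suc j)\<close> and at most one old point \<open>x b\<close> can be far from \<open>0\<close> after multiplication by \<open>k\<close>.\<close>

lemma integral_law_le:
  fixes k :: nat
  assumes close: "real k * r (Suc j) \<le> \<delta>"
    and small: "\<And>i. i \<le> j \<Longrightarrow> i \<noteq> b \<Longrightarrow> infdist (real k * x i) \<int> \<le> \<delta>"
    and prob: "\<And>i. measure uniform_unit {t. cell v (Suc j) t = i} \<le> \<epsilon>"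
  shows "(\<integral>\<theta>. circle_norm (int_mult (int k) \<theta>) \<partial>law) \<le> 2 * \<delta> + 2 * \<epsilon>"
proof -
  interpret prob_space uniform_unit
    by (rule prob_space_uniform_unit)
  define C where "C = (\<lambda>i. {t. cell v (Suc j) t = i})"
  have [measurable]: "C i \<in> sets borel" for i
    unfolding C_def by measurable
  have "\<delta> \<ge> 0"
    using close r_pos[of "Suc j"] by (meson less_imp_le mult_nonneg_nonneg of_nat_0_le_iff order_trans)
  \<comment> \<open>On the two bad cells the trivial bound 1 is used. Elsewhere one
    \<open>\<delta>\<close> comes from \<open>small\<close> at the cell's point and one from
    replacing the limit point by it. If \<open>b > Suc j\<close>, then \<open>C b\<close> is empty;
    if \<open>b = Suc j\<close>, that cell is merely counted twice.\<close>
  have bound: "infdist (real k * point t) \<int> \<le> 2 * \<delta> + indicator (C b) t + indicator (C (Suc j)) t"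
    if "0 \<le> t" for t
  proof (cases "t \<in> C b \<union> C (Suc j)")
    case True
    then have "1 \<le> indicator (C b) t + (indicator (C (Suc j)) t :: real)"
      by (auto simp: indicator_def)
    moreover have "infdist (real k * point t) \<int> \<le> 1"
      using circle_norm_le_half[of "to_circle (real k * point t)"]
      by (simp add: circle_norm_to_circle)
    ultimately show ?thesis
      using \<open>\<delta> \<ge> 0\<close> by linarith
  next
    case False
    define i where "i = cell v (Suc j) t"
    have i: "i \<le> j" "i \<noteq> b"
      using False cell_le[of v "Suc j" t] by (auto simp: C_def i_def le_Suc_eq simp del: cell.simps)
    have "infdist (real k * point t) \<int> \<le> infdist (real k * x i) \<int> + dist (real k * point t) (real k * x i)"
      by (rule infdist_triangle)
    also have "dist (real k * point t) (real k * x i) = real k * \<bar>point t - x i\<bar>"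
      by (simp add: dist_real_def abs_mult flip: right_diff_distrib)
    also have "\<dots> \<le> real k * r (Suc j)"
      using point_near[OF that, of "Suc j"] by (intro mult_left_mono) (auto simp: i_def)
    finally show ?thesis
      using small[OF i] close False by simp
  qed
  have "(\<integral>\<theta>. circle_norm (int_mult (int k) \<theta>) \<partial>law)
      = (\<integral>t. infdist (real k * point t) \<int> \<partial>uniform_unit)"
    by (simp add: integral_law)
  also have "\<dots> \<le> (\<integral>t. 2 * \<delta> + indicator (C b) t + indicator (C (Suc j)) t \<partial>uniform_unit)"
  proof (rule integral_mono_AE')
    show "AE t in uniform_unit. infdist (real k * point t) \<int>
        \<le> 2 * \<delta> + indicator (C b) t + indicator (C (Suc j)) t"
      using AE_uniform_unit by eventually_elim (use bound in auto)
  qed (use \<open>\<delta> \<ge> 0\<close> in \<open>auto simp: infdist_nonneg emeasure_eq_measure intro!: Bochner_Integration.integrable_add\<close>)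
  also have "\<dots> = 2 * \<delta> + measure uniform_unit (C b) + measure uniform_unit (C (Suc j))"
    using prob_space by (simp add: emeasure_eq_measure)
  also have "\<dots> \<le> 2 * \<delta> + 2 * \<epsilon>"
    using prob[of b] prob[of "Suc j"] by (simp add: C_def del: cell.simps)
  finally show ?thesis .
qed

end

section \<open>Windows of times and the final convergence\<close>

lemma strict_mono_nat_window:
  fixes T :: "nat \<Rightarrow> nat"
  assumes "strict_mono T" and "T J \<le> n"
  obtains j where "j \<ge> J" "T j \<le> n" "n < T (Suc j)"
proof -
  \<comment> \<open>The predecessor of the first \<open>k\<close> with \<open>n < T k\<close> is the
    index sought; it exists because \<open>J < k\<close>.\<close>
  define k where "k = (LEAST k. n < T k)"
  have "n < T (Suc n)"
    using strict_mono_imp_increasing[OF assms(1), of "Suc n"] by simp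
  then have k: "n < T k"
    unfolding k_def by (rule LeastI)
  then have "J < k"
    using assms by (metis leD le_less_trans not_le strict_mono_less_eq)
  then obtain j where j: "k = Suc j"
    by (cases k) auto
  then have "T j \<le> n"
    using not_less_Least[of j "\<lambda>k. n < T k"] by (simp add: k_def not_less)
  with j k \<open>J < k\<close> that[of j] show ?thesis
    by simp
qed

theorem theorem2:
  fixes \<alpha> :: "nat \<Rightarrow> circle" and m :: "nat \<Rightarrow> nat"
  assumes "rationally_independent \<alpha>"
    and "\<forall>n \<ge> 1. 1 \<le> m n"
    and "strict_mono_on {1..} m"
    and "\<forall>\<theta> :: real. \<theta> \<notin> \<rat> \<longrightarrow> closure ((\<lambda>n. to_circle (real (m n) * \<theta>)) ` {1..}) = UNIV"
    and "\<forall>\<epsilon> > (0 :: real). \<forall>k \<ge> 1. \<exists>N\<^sub>0 \<ge> 1. \<forall>n \<ge> N\<^sub>0.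
           k - 1 \<le> card {i \<in> {1..k}. circle_norm (int_mult (int (m n)) (\<alpha> i)) < \<epsilon>}"
    and "\<forall>k \<ge> 2. infinite {n. 1 \<le> n \<and> \<not> k dvd m n}"
  shows "\<exists>\<mu> :: circle measure.
           prob_space \<mu> \<and> sets \<mu> = sets borel \<and>
           (\<forall>x. emeasure \<mu> {x} = 0) \<and>
           ((\<lambda>n. \<integral>\<theta>. circle_norm (int_mult (int (m n)) \<theta>) \<partial>\<mu>) \<longlonglongrightarrow> 0)"
proof -
  have "\<exists>y. \<alpha> (Suc i) = to_circle y" for i
    by (cases "\<alpha> (Suc i)") auto
  then obtain a where a: "\<And>i. \<alpha> (Suc i) = to_circle (a i)"
    by metis
  have irr: "a i \<notin> \<rat>" for i
    using irrational_of_rationally_independent[OF assms(1) _ a] by simp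
  have one_bad: "\<exists>N. \<forall>n\<ge>N. \<exists>b. \<forall>i<k. i \<noteq> b \<longrightarrow> infdist (real (m n) * a i) \<int> < \<epsilon>"
    if pos: "\<epsilon> > 0" for \<epsilon> k
  proof -
    \<comment> \<open>Using (b) with \<open>Suc k\<close> turns its truncated \<open>k - 1\<close>
      into \<open>k\<close>, leaving at most one bad index among \<open>Suc k\<close>. Since
      \<open>a\<close> is indexed from 0, that index becomes \<open>b - 1\<close> below.\<close>
    obtain N where N: "\<And>n. n \<ge> N \<Longrightarrow>
        k \<le> card {i \<in> {1..Suc k}. circle_norm (int_mult (int (m n)) (\<alpha> i)) < \<epsilon>}"
      using assms(5)[rule_format, OF pos, of "Suc k"] by auto
    have "\<exists>b. \<forall>i<k. i \<noteq> b \<longrightarrow> infdist (real (m n) * a i) \<int> < \<epsilon>" if "n \<ge> N" for n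
    proof -
      define G where "G = {i \<in> {1..Suc k}. circle_norm (int_mult (int (m n)) (\<alpha> i)) < \<epsilon>}"
      have "card ({1..Suc k} - G) = Suc k - card G"
        by (subst card_Diff_subset) (auto simp: G_def)
      also have "\<dots> \<le> 1"
        using N[OF that] by (simp add: G_def)
      finally obtain b where b: "{1..Suc k} - G \<subseteq> {b}"
        by (metis card_1_singletonE card_0_eq empty_subsetI finite_Diff finite_atLeastAtMost
            le_eq_less_or_eq less_one subset_refl)
      have "infdist (real (m n) * a i) \<int> < \<epsilon>" if "i < k" "i \<noteq> b - 1" for i
      proof -
        have "Suc i \<in> {1..Suc k}" "Suc i \<noteq> b"
          using that by auto
        with b have "Suc i \<in> G"
          by blast
        then show ?thesis
          by (simp add: G_def a int_mult_to_circle circle_norm_to_circle)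
      qed
      then show ?thesis
        by blast
    qed
    then show ?thesis
      by blast
  qed
  obtain v :: "nat \<Rightarrow> real" where v: "v 0 = 0" "\<And>a b. a < b \<Longrightarrow> \<exists>i. a < v i \<and> v i < b"
    using dense_real_sequence by blast
  obtain x T r where T: "strict_mono T" and st: "\<And>j. stage a m j x (T j) (r j)"
    and near: "\<And>j. \<bar>x (Suc j) - x (cell v j (v (Suc j)))\<bar> \<le> r j / 2"
    and r: "\<And>j. r (Suc j) \<le> r j / 2"
    \<comment> \<open>The parent of \<open>Suc j\<close> is the cell that the cut point
      \<open>v (Suc j)\<close> splits.\<close>
    using stage_sequence[OF irr one_bad, of "\<lambda>j. cell v (j - 1) (v j)"] cell_le
    by (metis diff_Suc_1)
  interpret refining_points v x r
    by unfold_locales (use v st near r in \<open>auto simp: stage_def\<close>)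
  have "(\<lambda>n. \<integral>\<theta>. circle_norm (int_mult (int (m n)) \<theta>) \<partial>law) \<longlonglongrightarrow> 0"
  proof (rule LIMSEQ_I)
    fix e :: real
    assume "e > 0"
    obtain J where J: "\<And>j i. j \<ge> J \<Longrightarrow> measure uniform_unit {t. cell v j t = i} \<le> e / 8"
      using prob_cell[of "e / 8"] \<open>e > 0\<close> by auto
    obtain K where K: "(1/2) ^ K < e / 8"
      using real_arch_pow_inv[of "e / 8" "1/2"] \<open>e > 0\<close> by auto
    have "norm ((\<integral>\<theta>. circle_norm (int_mult (int (m n)) \<theta>) \<partial>law) - 0) < e"
      if n: "n \<ge> T (max J K)" for n
    proof -
      obtain j where j: "j \<ge> max J K" "T j \<le> n" "n < T (Suc j)"
        using strict_mono_nat_window[OF T n] .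
      have pow: "(1/2 :: real) ^ j \<le> (1/2) ^ K"
        using j by (intro power_decreasing) auto
      \<comment> \<open>Stage \<open>j\<close> controls the old points because
        \<open>T j \<le> n\<close>; stage \<open>Suc j\<close> controls the radius because
        \<open>n < T (Suc j)\<close>.\<close>
      have "\<exists>b. \<forall>i\<le>j. i \<noteq> b \<longrightarrow> infdist (real (m n) * x i) \<int> < (1/2) ^ j"
        using st[of j] j unfolding stage_def by blast
      then obtain b where "\<And>i. i \<le> j \<Longrightarrow> i \<noteq> b \<Longrightarrow> infdist (real (m n) * x i) \<int> < (1/2) ^ j"
        by blast
      moreover have "real (m n) * r (Suc j) \<le> (1/2) ^ Suc j"
        using st[of "Suc j"] j unfolding stage_def by blast
      then have "real (m n) * r (Suc j) \<le> (1/2) ^ j"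
        by (rule order_trans) (simp add: power_decreasing)
      ultimately have "(\<integral>\<theta>. circle_norm (int_mult (int (m n)) \<theta>) \<partial>law) \<le> 2 * (1/2) ^ j + 2 * (e / 8)"
        using J[of "Suc j"] j
        by (intro integral_law_le[where j = j and b = b]) (auto simp: less_imp_le simp del: cell.simps)
      also have "\<dots> < e"
        using pow K \<open>e > 0\<close> by linarith
      finally show ?thesis
        by (simp add: integral_nonneg_AE circle_norm_nonneg)
    qed
    then show "\<exists>N. \<forall>n\<ge>N. norm ((\<integral>\<theta>. circle_norm (int_mult (int (m n)) \<theta>) \<partial>law) - 0) < e"
      by blast
  qed
  then show ?thesis
    using prob_space_law sets_law law_continuous by blast
qed

end
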